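(* Let $\widehat{A}=A+\epsilon B\in\mathbb{DR}^{n\times n}$ with $\operatorname{Ind}(A)=m$, and write $\widehat{A}^{m}=A^{m}+\epsilon S$, where $S=\sum_{i=1}^{m}A^{m-i}BA^{i-1}$. If both the dual core-EP generalized inverse $\widehat{A}^{\dagger_c}$ and the dual Drazin generalized inverse $\widehat{A}^{D}$ exist, then $$\widehat{A}^{\dagger_c}=\widehat{A}^{D}\widehat{A}^{m}(\widehat{A}^{m})^{\dagger}$$ and $$\widehat{A}^{\dagger_c}=A^{\dagger_c}+\epsilon\Big[-A^{\dagger_c}S(A^{m})^{\dagger}+A^{D}A^{m}\big((A^{m})^{T}A^{m}\big)^{\dagger}S^{T}\big(I-A^{m}(A^{m})^{\dagger}\big)+A^{D}S(A^{m})^{\dagger}-A^{D}BA^{D}A^{m}(A^{m})^{\dagger}+\sum_{i=0}^{m-1}A^{\pi}A^{i}B(A^{D})^{i+2}A^{m}(A^{m})^{\dagger}\Big],$$ where $A^{\pi}=I-AA^{D}$.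
   Context: Dual numbers are $a+\epsilon b$ with $a,b\in\mathbb{R}$, $\epsilon\neq 0$, $\epsilon^2=0$. $\mathbb{DR}^{n\times n}$ is the set of dual real matrices $\widehat{A}=A+\epsilon B$, $A,B\in\mathbb{R}^{n\times n}$, with product $(A+\epsilon B)(C+\epsilon D)=AC+\epsilon(AD+BC)$ and transpose $(A+\epsilon B)^T=A^T+\epsilon B^T$. $\operatorname{Ind}(A)$ is the smallest nonnegative integer $s$ with $\operatorname{rank}(A^{s+1})=\operatorname{rank}(A^s)$. For a real square matrix $A$ of index $m$: $A^{\dagger}$ is the Moore-Penrose inverse, $A^{D}$ the Drazin inverse, and $A^{\dagger_c}$ the core-EP inverse, i.e. the unique real $X$ with $(AX)^T=AX$, $AX^2=X$, $XA^{m+1}=A^m$. For a dual matrix $\widehat{A}=A+\epsilon B$ with $\operatorname{Ind}(A)=m$: the dual core-EP generalized inverse $\widehat{A}^{\dagger_c}$ is the $\widehat{X}\in\mathbb{DR}^{n\times n}$ (unique if it exists) with $(\widehat{A}\widehat{X})^{T}=\widehat{A}\widehat{X}$, $\widehat{A}\widehat{X}^{2}=\widehat{X}$, $\widehat{X}\widehat{A}^{m+1}=\widehat{A}^{m}$; the dual Drazin generalized inverse $\widehat{A}^{D}$ is the $\widehat{X}$ (unique if it exists) with $\widehat{X}\widehat{A}^{m+1}=\widehat{A}^m$, $\widehat{X}\widehat{A}\widehat{X}=\widehat{X}$, $\widehat{A}\widehat{X}=\widehat{X}\widehat{A}$. For a dual matrix $\widehat{C}$, the dual Moore-Penrose inverse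 $\widehat{C}^{\dagger}$ is the $\widehat{X}$ (unique if it exists) with $\widehat{C}\widehat{X}\widehat{C}=\widehat{C}$, $\widehat{X}\widehat{C}\widehat{X}=\widehat{X}$, $(\widehat{C}\widehat{X})^T=\widehat{C}\widehat{X}$, $(\widehat{X}\widehat{C})^T=\widehat{X}\widehat{C}$; it is a known result that $(\widehat{A}^m)^{\dagger}$ exists if and only if $\widehat{A}^{D}$ exists. *)

theory Defs
  imports "HOL-Analysis.Analysis"
begin

section \<open>Dual numbers\<close>

text \<open>\<open>Dual a b\<close> stands for \<open>a + \<epsilon> b\<close>, with \<open>\<epsilon>\<^sup>2 = 0\<close>.\<close>

datatype dual = Dual (std_part: real) (inf_part: real)

instantiation dual :: comm_ring_1
begin

definition zero_dual :: dual where "0 = Dual 0 0"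
definition one_dual :: dual where "1 = Dual 1 0"
definition plus_dual :: "dual \<Rightarrow> dual \<Rightarrow> dual" where
  "x + y = Dual (std_part x + std_part y) (inf_part x + inf_part y)"
definition minus_dual :: "dual \<Rightarrow> dual \<Rightarrow> dual" where
  "x - y = Dual (std_part x - std_part y) (inf_part x - inf_part y)"
definition uminus_dual :: "dual \<Rightarrow> dual" where
  "- x = Dual (- std_part x) (- inf_part x)"
definition times_dual :: "dual \<Rightarrow> dual \<Rightarrow> dual" where
  "x * y = Dual (std_part x * std_part y) (std_part x * inf_part y + inf_part x * std_part y)"

instance
  by standard
    (auto simp: zero_dual_def one_dual_def plus_dual_def minus_dual_def uminus_dual_def
      times_dual_def algebra_simps)

end

lemma std_part_simps [simp]:
  "std_part 0 = 0" "std_part 1 = 1" "std_part (x + y) = std_part x + std_part y"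
  "std_part (x - y) = std_part x - std_part y" "std_part (- x) = - std_part x"
  "std_part (x * y) = std_part x * std_part y"
  by (simp_all add: zero_dual_def one_dual_def plus_dual_def minus_dual_def uminus_dual_def
      times_dual_def)

lemma inf_part_simps [simp]:
  "inf_part 0 = 0" "inf_part 1 = 0" "inf_part (x + y) = inf_part x + inf_part y"
  "inf_part (x - y) = inf_part x - inf_part y" "inf_part (- x) = - inf_part x"
  "inf_part (x * y) = std_part x * inf_part y + inf_part x * std_part y"
  by (simp_all add: zero_dual_def one_dual_def plus_dual_def minus_dual_def uminus_dual_def
      times_dual_def)

lemma std_part_sum [simp]: "std_part (sum f I) = (\<Sum>i\<in>I. std_part (f i))"
  by (induction I rule: infinite_finite_induct) auto

lemma inf_part_sum [simp]: "inf_part (sum f I) = (\<Sum>i\<in>I. inf_part (f i))"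
  by (induction I rule: infinite_finite_induct) auto


section \<open>Matrix powers and index\<close>

text \<open>The class-based power \<open>A ^ k\<close> on \<^typ>\<open>real^'n^'n\<close> is the entrywise one, so the power
  with respect to \<open>**\<close> is introduced separately.\<close>

primrec matpow :: "'a::semiring_1^'n^'n \<Rightarrow> nat \<Rightarrow> 'a^'n^'n" where
  "matpow A 0 = mat 1"
| "matpow A (Suc k) = A ** matpow A k"

definition mat_index :: "real^'n^'n \<Rightarrow> nat" where
  "mat_index A = (LEAST s. rank (matpow A (s + 1)) = rank (matpow A s))"


section \<open>Dual matrices\<close>

text \<open>\<open>dual_mat A B\<close> is the dual matrix \<open>A + \<epsilon> B\<close>.\<close>

definition dual_mat :: "real^'n^'m \<Rightarrow> real^'n^'m \<Rightarrow> dual^'n^'m" where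
  "dual_mat A B = (\<chi> i j. Dual (A $ i $ j) (B $ i $ j))"

definition std_mat :: "dual^'n^'m \<Rightarrow> real^'n^'m" where
  "std_mat M = (\<chi> i j. std_part (M $ i $ j))"

definition inf_mat :: "dual^'n^'m \<Rightarrow> real^'n^'m" where
  "inf_mat M = (\<chi> i j. inf_part (M $ i $ j))"

lemma std_mat_dual_mat [simp]: "std_mat (dual_mat A B) = A"
  by (simp add: std_mat_def dual_mat_def vec_eq_iff)

lemma inf_mat_dual_mat [simp]: "inf_mat (dual_mat A B) = B"
  by (simp add: inf_mat_def dual_mat_def vec_eq_iff)

lemma dual_mat_collapse [simp]: "dual_mat (std_mat M) (inf_mat M) = M"
  by (simp add: std_mat_def inf_mat_def dual_mat_def vec_eq_iff)

lemma dual_mat_eq_iff: "dual_mat A B = dual_mat C D \<longleftrightarrow> A = C \<and> B = D"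
  by (metis std_mat_dual_mat inf_mat_dual_mat)

lemma dual_mat_mult: "dual_mat A B ** dual_mat C D = dual_mat (A ** C) (A ** D + B ** C)"
  by (simp add: dual_mat_def matrix_matrix_mult_def vec_eq_iff dual.expand sum.distrib)

lemma dual_mat_transpose: "transpose (dual_mat A B) = dual_mat (transpose A) (transpose B)"
  by (simp add: dual_mat_def transpose_def vec_eq_iff)

lemma dual_mat_one: "mat 1 = dual_mat (mat 1) 0"
  by (simp add: dual_mat_def mat_def vec_eq_iff zero_dual_def one_dual_def)

lemma matpow_dual_mat:
  fixes A B :: "real^'n^'n"
  shows
    "matpow (dual_mat A B) m =
       dual_mat (matpow A m) (\<Sum>i=1..m. matpow A (m - i) ** B ** matpow A (i - 1))"
proof (induction m)
  case 0
  show ?case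
    by (simp add: dual_mat_one)
next
  case (Suc m)
  have distr: "A ** sum f I = (\<Sum>i\<in>I. A ** f i)" for f :: "nat \<Rightarrow> real^'n^'n" and I
    by (induction I rule: infinite_finite_induct) (auto simp: matrix_add_ldistrib)
  have "A ** (\<Sum>i=1..m. matpow A (m - i) ** B ** matpow A (i - 1)) =
          (\<Sum>i=1..m. matpow A (Suc m - i) ** B ** matpow A (i - 1))"
    unfolding distr by (intro sum.cong) (auto simp: matrix_mul_assoc Suc_diff_le)
  with Suc show ?case
    by (simp add: dual_mat_mult)
qed


section \<open>Generalized inverses\<close>

text \<open>
  The defining equations make sense over any commutative ring; they are used both over \<^typ>\<open>real\<close>
  and over \<^typ>\<open>dual\<close>.  For a dual matrix the parameter \<open>m\<close> is the index of its standard part.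
\<close>

definition is_moore_penrose :: "'a::comm_ring_1^'n^'m \<Rightarrow> 'a^'m^'n \<Rightarrow> bool" where
  "is_moore_penrose C X \<longleftrightarrow>
     C ** X ** C = C \<and> X ** C ** X = X \<and>
     transpose (C ** X) = C ** X \<and> transpose (X ** C) = X ** C"

definition is_core_ep :: "nat \<Rightarrow> 'a::comm_ring_1^'n^'n \<Rightarrow> 'a^'n^'n \<Rightarrow> bool" where
  "is_core_ep m A X \<longleftrightarrow>
     transpose (A ** X) = A ** X \<and> A ** matpow X 2 = X \<and>
     X ** matpow A (m + 1) = matpow A m"

definition is_drazin :: "nat \<Rightarrow> 'a::comm_ring_1^'n^'n \<Rightarrow> 'a^'n^'n \<Rightarrow> bool" where
  "is_drazin m A X \<longleftrightarrow>
     X ** matpow A (m + 1) = matpow A m \<and> X ** A ** X = X \<and> A ** X = X ** A"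

lemma is_moore_penrose_unique:
  assumes "is_moore_penrose C X" "is_moore_penrose C Y"
  shows "X = Y"
proof -
  note X = assms(1)[unfolded is_moore_penrose_def] and Y = assms(2)[unfolded is_moore_penrose_def]
  have "C ** X = transpose (C ** Y ** (C ** X))"
    using X Y by (metis matrix_mul_assoc)
  also have "\<dots> = C ** X ** (C ** Y)"
    using X Y by (metis matrix_transpose_mul)
  also have "\<dots> = C ** Y"
    using X by (metis matrix_mul_assoc)
  finally have CXY: "C ** X = C ** Y" .
  have "X ** C = transpose (X ** C ** (Y ** C))"
    using X Y by (metis matrix_mul_assoc)
  also have "\<dots> = Y ** C ** (X ** C)"
    using X Y by (metis matrix_transpose_mul)
  also have "\<dots> = Y ** C"
    using X by (metis matrix_mul_assoc)
  finally have "X ** C = Y ** C" .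
  with CXY X Y show ?thesis
    by (metis matrix_mul_assoc)
qed

lemma matpow_Suc2: "matpow A (Suc k) = matpow A k ** A"
  by (induction k) (simp_all add: matrix_mul_assoc)

lemma core_ep_aux:
  assumes "A ** matpow X 2 = X"
  shows "matpow A k ** matpow X (Suc k) = X"
proof (induction k)
  case (Suc k)
  have "matpow A (Suc k) ** matpow X (Suc (Suc k)) = matpow A k ** ((A ** matpow X 2) ** matpow X k)"
    unfolding matpow_Suc2[of A k] by (simp add: numeral_2_eq_2 matrix_mul_assoc)
  with assms Suc show ?case
    by simp
qed simp

lemma is_core_ep_unique:
  assumes "is_core_ep m A X" "is_core_ep m A Y"
  shows "X = Y"
proof -
  have absorb: "V ** A ** U = U" if "is_core_ep m A U" "is_core_ep m A V" for U V
  proof -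
    have U: "matpow A m ** matpow U (Suc m) = U"
      using that(1) by (simp add: is_core_ep_def core_ep_aux del: matpow.simps)
    have "V ** A ** (matpow A m ** matpow U (Suc m)) = (V ** matpow A (m + 1)) ** matpow U (Suc m)"
      by (simp add: matrix_mul_assoc)
    also have "\<dots> = U"
      using that(2) U by (simp add: is_core_ep_def)
    finally show ?thesis
      using U by simp
  qed
  have "A ** X = transpose (A ** Y ** (A ** X))"
    using assms absorb[OF assms] by (metis is_core_ep_def matrix_mul_assoc)
  also have "\<dots> = A ** X ** (A ** Y)"
    using assms by (metis is_core_ep_def matrix_transpose_mul)
  also have "\<dots> = A ** Y"
    using absorb[OF assms(2,1)] by (metis matrix_mul_assoc)
  finally show ?thesis
    using absorb[OF assms] absorb[OF assms(2) assms(2)] by (metis matrix_mul_assoc)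
qed

lemma is_drazin_unique:
  assumes "is_drazin m A X" "is_drazin m A Y"
  shows "X = Y"
proof -
  have pow: "matpow A k ** matpow U (Suc k) = U \<and> matpow U (Suc k) ** matpow A k = U"
    if "is_drazin m A U" for U k
  proof (induction k)
    case (Suc k)
    have U: "U ** U ** A = U" "A ** U ** U = U"
      using that by (metis is_drazin_def matrix_mul_assoc)+
    have "matpow A (Suc k) ** matpow U (Suc (Suc k)) = matpow A k ** ((A ** U ** U) ** matpow U k)"
      unfolding matpow_Suc2[of A k] by (simp add: matrix_mul_assoc)
    moreover have
      "matpow U (Suc (Suc k)) ** matpow A (Suc k) = matpow U k ** (U ** U ** A) ** matpow A k"
      unfolding matpow_Suc2[of U] by (simp add: matrix_mul_assoc)
    ultimately show ?case
      using Suc U by (metis matpow.simps(2) matpow_Suc2)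
  qed simp
  have left: "V ** A ** U = U" if "is_drazin m A U" "is_drazin m A V" for U V
  proof -
    have "V ** A ** (matpow A m ** matpow U (Suc m)) = (V ** matpow A (m + 1)) ** matpow U (Suc m)"
      by (simp add: matrix_mul_assoc)
    with that pow[OF that(1), of m] show ?thesis
      by (simp add: is_drazin_def)
  qed
  have right: "U ** A ** V = U" if "is_drazin m A U" "is_drazin m A V" for U V
  proof -
    have comm: "matpow A k ** V = V ** matpow A k" for k
      using that(2) by (induction k) (auto simp: is_drazin_def, metis matrix_mul_assoc)
    have "matpow U (Suc m) ** matpow A m ** A ** V = matpow U (Suc m) ** (matpow A (m + 1) ** V)"
      by (simp only: matpow_Suc2[of A] matrix_mul_assoc Suc_eq_plus1[symmetric])
    also have "\<dots> = U"
      using that pow[OF that(1), of m] comm by (simp add: is_drazin_def del: matpow.simps)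
    finally show ?thesis
      using pow[OF that(1), of m] by simp
  qed
  show ?thesis
    using left[OF assms] right[OF assms(2,1)] by simp
qed

text \<open>
  By the uniqueness lemmas above, \<open>THE\<close> denotes the inverse whenever it exists.  Over the reals all
  three inverses always exist; over the dual numbers existence is a genuine condition.
\<close>

definition moore_penrose :: "'a::comm_ring_1^'n^'m \<Rightarrow> 'a^'m^'n" where
  "moore_penrose C = (THE X. is_moore_penrose C X)"

definition core_ep :: "real^'n^'n \<Rightarrow> real^'n^'n" where
  "core_ep A = (THE X. is_core_ep (mat_index A) A X)"

definition drazin :: "real^'n^'n \<Rightarrow> real^'n^'n" where
  "drazin A = (THE X. is_drazin (mat_index A) A X)"

definition has_dual_core_ep :: "dual^'n^'n \<Rightarrow> bool" where
  "has_dual_core_ep A \<longleftrightarrow> (\<exists>X. is_core_ep (mat_index (std_mat A)) A X)"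

definition dual_core_ep :: "dual^'n^'n \<Rightarrow> dual^'n^'n" where
  "dual_core_ep A = (THE X. is_core_ep (mat_index (std_mat A)) A X)"

definition has_dual_drazin :: "dual^'n^'n \<Rightarrow> bool" where
  "has_dual_drazin A \<longleftrightarrow> (\<exists>X. is_drazin (mat_index (std_mat A)) A X)"

definition dual_drazin :: "dual^'n^'n \<Rightarrow> dual^'n^'n" where
  "dual_drazin A = (THE X. is_drazin (mat_index (std_mat A)) A X)"

definition spectral_proj :: "real^'n^'n \<Rightarrow> real^'n^'n" where
  "spectral_proj A = mat 1 - A ** drazin A"

end

theory Submission
  imports Defs
begin

text \<open>
  Over any commutative ring, if \<open>X\<close> is a Drazin inverse of \<open>A\<close> and \<open>P\<close> a Moore-Penrose inverse
  of \<open>A\<^sup>m\<close>, then \<open>X A\<^sup>m P\<close> satisfies the three core-EP equations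
  (\<open>is_core_ep_drazin_moore_penrose\<close>). For the dual matrix \<open>A + \<epsilon> B\<close> this yields the first
  identity, by uniqueness, as soon as its \<open>m\<close>-th power \<open>A\<^sup>m + \<epsilon> S\<close> has a Moore-Penrose
  inverse.

  That inverse is written down explicitly. With \<open>C = A\<^sup>m\<close> and \<open>P = C\<^sup>\<dagger>\<close>, a Moore-Penrose inverse
  of \<open>C + \<epsilon> S\<close> is
  \<open>P + \<epsilon> (- P S P + P P\<^sup>T S\<^sup>T (I - C P) + (I - P C) S\<^sup>T P\<^sup>T P)\<close>, provided that
  \<open>(I - C P) S (I - P C) = 0\<close> (\<open>dual_moore_penrose_formula\<close>). The proviso holds whenever
  \<open>C + \<epsilon> S\<close> has some inner inverse (\<open>dual_inner_inverse_obstruction\<close>), and the \<open>m\<close>-th power of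
  the dual Drazin inverse is one.

  The second identity is the infinitesimal part of the product
  \<open>(D + \<epsilon> D1) (C + \<epsilon> S) (P + \<epsilon> P1)\<close>, that is \<open>D C P1 + D S P + D1 C P\<close>. In \<open>D C P1\<close> the last
  term of \<open>P1\<close> is cancelled by \<open>C (I - P C) = 0\<close>; the others are as stated because
  \<open>D C P = A\<^sup>\<dagger>\<^sup>c\<close> and \<open>P P\<^sup>T = (C\<^sup>T C)\<^sup>\<dagger>\<close>. The product \<open>D1 C\<close> is read off the infinitesimal
  part of the defining equation of the Drazin inverse (\<open>dual_drazin_inf_part_times_power\<close>);
  knowing \<open>D1\<close> itself would bring in further terms that \<open>C\<close> cancels.
\<close>

section \<open>Matrix algebra\<close>

lemma matrix_add_rdist: "(A + B) ** C = A ** C + B ** (C :: 'a::semiring_1^'p^'n)"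
  by (simp add: matrix_matrix_mult_def vec_eq_iff sum.distrib distrib_right)

lemma matrix_diff_ldist: "A ** (B - C) = A ** B - A ** (C :: 'a::ring_1^'p^'n)"
  by (simp add: matrix_matrix_mult_def vec_eq_iff sum_subtractf right_diff_distrib)

lemma matrix_diff_rdist: "(A - B) ** C = A ** C - B ** (C :: 'a::ring_1^'p^'n)"
  by (simp add: matrix_matrix_mult_def vec_eq_iff sum_subtractf left_diff_distrib)

lemma matrix_minus_left: "(- A) ** B = - (A ** (B :: 'a::ring_1^'p^'n))"
  by (simp add: matrix_matrix_mult_def vec_eq_iff sum_negf)

lemma matrix_minus_right: "A ** (- B) = - (A ** (B :: 'a::ring_1^'p^'n))"
  by (simp add: matrix_matrix_mult_def vec_eq_iff sum_negf)

lemma transpose_add: "transpose (A + B) = transpose A + transpose B"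
  by (simp add: transpose_def vec_eq_iff)

lemma transpose_diff: "transpose (A - B) = transpose A - transpose B"
  by (simp add: transpose_def vec_eq_iff)

lemma transpose_minus: "transpose (- A) = - transpose A"
  by (simp add: transpose_def vec_eq_iff)

lemmas matrix_ring_simps =
  matrix_add_ldistrib matrix_add_rdist matrix_diff_ldist matrix_diff_rdist
  matrix_minus_left matrix_minus_right transpose_add transpose_diff transpose_minus
  matrix_mul_assoc[symmetric]

lemma matrix_sum_ldist:
  "A ** (\<Sum>i\<in>I. f i) = (\<Sum>i\<in>I. A ** (f i :: 'a::semiring_1^'p^'n))"
  by (induction I rule: infinite_finite_induct) (auto simp: matrix_add_ldistrib)

lemma matrix_sum_rdist:
  "(\<Sum>i\<in>I. f i) ** A = (\<Sum>i\<in>I. f i ** (A :: 'a::semiring_1^'p^'n))"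
  by (induction I rule: infinite_finite_induct) (auto simp: matrix_add_rdist)

lemma matpow_commute:
  assumes "X ** Y = Y ** X"
  shows "X ** matpow Y k = matpow Y k ** X"
  by (induction k) (simp, metis assms matrix_mul_assoc matpow.simps(2))

lemma matpow_add: "matpow X (j + k) = matpow X j ** matpow X k"
  by (induction j) (simp_all add: matrix_mul_assoc)


section \<open>The Moore-Penrose inverse of a real matrix\<close>

lemma moore_penrose_eqI: "is_moore_penrose C X \<Longrightarrow> moore_penrose C = X"
  unfolding moore_penrose_def using is_moore_penrose_unique by blast

text \<open>Over the reals every linear map has a right inverse on its range, which is an inner
  inverse of the matrix.\<close>

lemma inner_inverse_exists: "\<exists>G. C ** G ** C = (C :: real^'n^'m)"
proof -
  obtain g where g: "linear g" "\<And>v. C *v (g (C *v v)) = C *v v"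
    using linear_exists_right_inverse_on[OF matrix_vector_mul_linear[of C] subspace_UNIV]
    by auto
  have "C ** matrix g ** C *v v = C *v v" for v
    using g by (simp add: matrix_vector_mul_assoc[symmetric] matrix_works)
  then show ?thesis
    by (metis matrix_eq)
qed

lemma transpose_mult_self_eq_0:
  assumes "transpose E ** E = (0 :: real^'n^'n)"
  shows "E = (0 :: real^'n^'m)"
proof -
  have "E *v v = 0" for v
  proof -
    have "(E *v v) \<bullet> (E *v v) = v \<bullet> ((transpose E ** E) *v v)"
      by (simp add: matrix_vector_mul_assoc[symmetric] dot_lmul_matrix del: transpose_matrix_vector)
         (metis dot_lmul_matrix inner_commute vector_transpose_matrix transpose_transpose)
    with assms show ?thesis
      by simp
  qed
  then show ?thesis
    by (metis matrix_eq matrix_vector_mult_0)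
qed

text \<open>Normal equations: if \<open>G\<close> is an inner inverse of \<open>C\<^sup>T C\<close>, then \<open>G C\<^sup>T\<close> solves the
  least squares problem for \<open>C\<close>, so \<open>C G C\<^sup>T\<close> is the orthogonal projection onto the range
  of \<open>C\<close>.\<close>

lemma least_squares_inverse_exists:
  "\<exists>X. C ** X ** C = C \<and> transpose (C ** X) = C ** (X :: real^'m^'n)"
proof -
  obtain G where G: "transpose C ** C ** G ** (transpose C ** C) = transpose C ** C"
    using inner_inverse_exists by blast
  define X where "X = G ** transpose C"
  have 0: "transpose C ** (C ** X ** C - C) = 0"
    using G by (simp add: X_def matrix_ring_simps)
  have "transpose (C ** X ** C - C) ** (C ** X ** C - C)
          = (transpose C ** transpose X - mat 1) ** (transpose C ** (C ** X ** C - C))"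
    by (simp add: matrix_ring_simps matrix_transpose_mul)
  then have CXC: "C ** X ** C = C"
    using 0 transpose_mult_self_eq_0[of "C ** X ** C - C"] by simp
  \<comment> \<open>A matrix \<open>Q = C X\<close> with \<open>Q Q\<^sup>T = Q\<^sup>T\<close> is symmetric.\<close>
  have "C ** X ** transpose (C ** X) = (C ** X ** C) ** (transpose G ** transpose C)"
    by (simp add: X_def matrix_transpose_mul matrix_mul_assoc)
  also have "\<dots> = transpose (C ** X)"
    unfolding CXC by (simp add: X_def matrix_transpose_mul matrix_mul_assoc)
  finally have "transpose (C ** X) = C ** X"
    by (metis matrix_transpose_mul transpose_transpose)
  with CXC show ?thesis
    by blast
qed

lemma real_moore_penrose_exists: "\<exists>X. is_moore_penrose C (X :: real^'m^'n)"
proof -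
  obtain X where X: "C ** X ** C = C" "transpose (C ** X) = C ** X"
    using least_squares_inverse_exists by blast
  obtain Z where Z: "transpose C ** Z ** transpose C = transpose C"
      "transpose (transpose C ** Z) = transpose C ** Z"
    using least_squares_inverse_exists by blast
  define Y where "Y = transpose Z"
  have Y: "C ** Y ** C = C" "transpose (Y ** C) = Y ** C"
    unfolding Y_def using Z by (metis matrix_transpose_mul transpose_transpose matrix_mul_assoc)+
  have "C ** (Y ** C ** X) = C ** X" "(Y ** C ** X) ** C = Y ** C"
    using X Y by (metis matrix_mul_assoc)+
  with X Y have "is_moore_penrose C (Y ** C ** X)"
    unfolding is_moore_penrose_def by (metis matrix_mul_assoc)
  then show ?thesis
    by blast
qed

lemma is_moore_penrose_moore_penrose: "is_moore_penrose C (moore_penrose (C :: real^'n^'m))"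
  using real_moore_penrose_exists moore_penrose_eqI by metis

text \<open>Rewriting rules, oriented for right-nested products, that cancel and turn each product
  \<open>C P\<close> or \<open>P C\<close> of transposes back into the product itself.\<close>

lemma is_moore_penrose_simps:
  assumes "is_moore_penrose C P"
  shows "C ** (P ** C) = C" "C ** (P ** (C ** Y)) = C ** Y"
    "P ** (C ** P) = P" "P ** (C ** (P ** Z)) = P ** Z"
    "transpose P ** transpose C = C ** P"
    "transpose P ** (transpose C ** Z) = C ** (P ** Z)"
    "transpose C ** transpose P = P ** C"
    "transpose C ** (transpose P ** Y) = P ** (C ** Y)"
    "C ** (P ** transpose P) = transpose P" "C ** (P ** (transpose P ** V)) = transpose P ** V"
    "transpose P ** (P ** C) = transpose P" "transpose P ** (P ** (C ** Y)) = transpose P ** Y"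
    "P ** (C ** transpose C) = transpose C" "P ** (C ** (transpose C ** Z)) = transpose C ** Z"
    "transpose C ** (C ** P) = transpose C" "transpose C ** (C ** (P ** Z)) = transpose C ** Z"
  using assms unfolding is_moore_penrose_def
  by (metis matrix_transpose_mul matrix_mul_assoc)+

lemma moore_penrose_gram:
  assumes "is_moore_penrose C P"
  shows "is_moore_penrose (transpose C ** C) (P ** transpose P)"
  unfolding is_moore_penrose_def
  by (simp add: matrix_transpose_mul matrix_mul_assoc[symmetric] is_moore_penrose_simps[OF assms])


section \<open>The Moore-Penrose inverse of a dual matrix\<close>

text \<open>The compression of the infinitesimal part \<open>S\<close> to the complements of the range and of the
  row space of \<open>C\<close> is the only obstruction: an inner inverse forces it to vanish, because
  \<open>S\<close> is then a sum of products each having \<open>C\<close> as its left or right factor.\<close>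

lemma dual_inner_inverse_obstruction:
  assumes "is_moore_penrose C P"
    and inner: "dual_mat C S ** Z ** dual_mat C S = dual_mat C S"
  shows "(mat 1 - C ** P) ** S ** (mat 1 - P ** C) = 0"
proof -
  define Z0 Z1 where "Z0 = std_mat Z" and "Z1 = inf_mat Z"
  have "Z = dual_mat Z0 Z1"
    by (simp add: Z0_def Z1_def)
  with inner have "C ** (Z0 ** S) + (C ** Z1 + S ** Z0) ** C = S"
    by (simp add: dual_mat_mult dual_mat_eq_iff matrix_mul_assoc)
  then have "(mat 1 - C ** P) ** S ** (mat 1 - P ** C)
      = (mat 1 - C ** P) ** (C ** (Z0 ** S) + (C ** Z1 + S ** Z0) ** C) ** (mat 1 - P ** C)"
    by simp
  also have "\<dots> = 0"
    by (simp add: matrix_ring_simps is_moore_penrose_simps[OF assms(1)])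
  finally show ?thesis .
qed

text \<open>The candidate is the first-order expansion of the Moore-Penrose inverse under the
  perturbation \<open>C + \<epsilon> S\<close>. Its two products with \<open>C + \<epsilon> S\<close> have infinitesimal parts
  \<open>E S P + (E S P)\<^sup>T\<close> and \<open>P S F + (P S F)\<^sup>T\<close>, where \<open>E = I - C P\<close> and \<open>F = I - P C\<close>. These
  are visibly symmetric and settle everything but \<open>C X C = C\<close>, which fails by exactly
  the term \<open>E S F\<close>.\<close>

lemma dual_moore_penrose_formula:
  assumes P: "is_moore_penrose C P"
    and obstruction: "(mat 1 - C ** P) ** S ** (mat 1 - P ** C) = 0"
  shows "is_moore_penrose (dual_mat C S)
    (dual_mat P (- (P ** S ** P) + P ** transpose P ** transpose S ** (mat 1 - C ** P)
      + (mat 1 - P ** C) ** transpose S ** transpose P ** P))"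
    (is "is_moore_penrose _ (dual_mat P ?P1)")
proof -
  note simps = matrix_ring_simps is_moore_penrose_simps[OF P] matrix_transpose_mul
  have left: "C ** ?P1 + S ** P = (mat 1 - C ** P) ** S ** P
      + transpose P ** transpose S ** (mat 1 - C ** P)"
    by (simp add: simps)
  have right: "P ** S + ?P1 ** C = P ** S ** (mat 1 - P ** C)
      + (mat 1 - P ** C) ** transpose S ** transpose P"
    by (simp add: simps)
  have "C ** P ** S + (C ** ?P1 + S ** P) ** C = S"
    unfolding left using obstruction by (simp add: simps algebra_simps)
  moreover have "P ** C ** ?P1 + (P ** S + ?P1 ** C) ** P = ?P1"
    unfolding right by (simp add: simps)
  moreover have "transpose (C ** ?P1 + S ** P) = C ** ?P1 + S ** P"
    unfolding left by (simp add: simps)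
  moreover have "transpose (P ** S + ?P1 ** C) = P ** S + ?P1 ** C"
    unfolding right by (simp add: simps)
  ultimately show ?thesis
    using P unfolding is_moore_penrose_def
    by (simp add: dual_mat_mult dual_mat_transpose dual_mat_eq_iff)
qed


section \<open>Drazin and core-EP inverses\<close>

lemma drazin_power_cancel:
  assumes "is_drazin m A X"
  shows "matpow X k ** matpow A k ** X = X"
proof (induction k)
  case (Suc k)
  have X: "X ** A ** X = X" "A ** X = X ** A"
    using assms by (auto simp: is_drazin_def)
  have comm: "matpow A k ** X = X ** matpow A k"
    using X(2) matpow_commute by metis
  have "matpow X (Suc k) ** matpow A (Suc k) ** X
      = matpow X k ** X ** A ** (matpow A k ** X)"
    unfolding matpow_Suc2[of X k] by (simp add: matrix_mul_assoc)
  also have "\<dots> = matpow X k ** (X ** A ** X) ** matpow A k"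
    by (simp add: comm matrix_mul_assoc)
  also have "\<dots> = X"
    unfolding X(1) using Suc comm by (simp add: matrix_mul_assoc[symmetric])
  finally show ?case .
qed simp

text \<open>For \<open>k = m\<close> this makes \<open>X\<^sup>m\<close> an inner inverse of \<open>A\<^sup>m\<close>, so that over the dual numbers
  a Drazin inverse of \<open>A\<close> removes the obstruction to a Moore-Penrose inverse of \<open>A\<^sup>m\<close>.\<close>

lemma drazin_power_inner_inverse:
  assumes "is_drazin m A X"
  shows "matpow A k ** matpow X k ** matpow A m = matpow A m"
proof (induction k)
  case (Suc k)
  have X: "X ** matpow A (m + 1) = matpow A m" "A ** X = X ** A"
    using assms by (auto simp: is_drazin_def)
  have comm: "matpow X k ** matpow A m = matpow A m ** matpow X k"
    using X(2) matpow_commute by metis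
  have "matpow A (Suc k) ** matpow X (Suc k) ** matpow A m
      = matpow A k ** (A ** X) ** (matpow X k ** matpow A m)"
    unfolding matpow_Suc2[of A k] by (simp add: matrix_mul_assoc)
  also have "\<dots> = matpow A k ** (X ** matpow A (m + 1)) ** matpow X k"
    by (simp add: comm X(2) matrix_mul_assoc)
  also have "\<dots> = matpow A m"
    using Suc comm by (simp only: X matrix_mul_assoc[symmetric])
  finally show ?case .
qed simp

text \<open>\<open>X\<close> inverts \<open>A\<close> on the range of \<open>A\<^sup>m\<close>, and \<open>A\<^sup>m P\<close> is the symmetric projection onto
  that range. Hence \<open>A (X A\<^sup>m P)\<close> is exactly this projection, which fixes \<open>X A\<^sup>m P\<close>
  (with \<open>X A\<^sup>m = A\<^sup>m X\<close>) and every product \<open>A\<^sup>m Y\<close>; the other two equations follow.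
  Being purely algebraic, the argument serves real and dual matrices alike.\<close>

lemma is_core_ep_drazin_moore_penrose:
  assumes X: "is_drazin m A X" and P: "is_moore_penrose (matpow A m) P"
  shows "is_core_ep m A (X ** matpow A m ** P)"
proof -
  define C where "C = matpow A m"
  have X: "X ** (A ** C) = C" "A ** X = X ** A"
    using X by (auto simp: is_drazin_def C_def)
  have CX: "X ** C = C ** X" and CA: "A ** C = C ** A"
    unfolding C_def using X(2) matpow_commute by metis+
  have P: "C ** (P ** C) = C" "transpose (C ** P) = C ** P"
    using P by (auto simp: is_moore_penrose_def C_def matrix_mul_assoc)
  have AX: "A ** (X ** C ** P) = C ** P"
    using X CA by (metis matrix_mul_assoc)
  have "A ** matpow (X ** C ** P) 2 = C ** P ** (X ** C) ** P"
    using AX by (simp add: numeral_2_eq_2 matrix_mul_assoc)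
  also have "\<dots> = X ** C ** P"
    using P by (simp add: CX matrix_mul_assoc)
  finally have AXX: "A ** matpow (X ** C ** P) 2 = X ** C ** P" .
  have "X ** C ** P ** (A ** C) = C"
    using X CA P by (metis matrix_mul_assoc)
  with AX AXX P show ?thesis
    by (simp add: is_core_ep_def C_def)
qed

lemma drazin_eqI: "is_drazin (mat_index A) A X \<Longrightarrow> drazin A = X"
  unfolding drazin_def using is_drazin_unique by blast

lemma dual_drazin_eqI: "is_drazin (mat_index (std_mat A)) A X \<Longrightarrow> dual_drazin A = X"
  unfolding dual_drazin_def using is_drazin_unique by blast

lemma core_ep_eqI: "is_core_ep (mat_index A) A X \<Longrightarrow> core_ep A = X"
  unfolding core_ep_def using is_core_ep_unique by blast

lemma dual_core_ep_eqI: "is_core_ep (mat_index (std_mat A)) A X \<Longrightarrow> dual_core_ep A = X"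
  unfolding dual_core_ep_def using is_core_ep_unique by blast

lemma is_drazin_std_part:
  assumes "is_drazin m (dual_mat A B) (dual_mat D D1)"
  shows "is_drazin m A D"
  using assms
  by (simp add: is_drazin_def matpow_dual_mat dual_mat_mult dual_mat_eq_iff del: matpow.simps)

text \<open>Comparing infinitesimal parts in \<open>X A\<^sup>m\<^sup>+\<^sup>1 = A\<^sup>m\<close> determines \<open>D1 A\<^sup>m\<^sup>+\<^sup>1\<close>; a further factor
  \<open>D\<close> lowers the exponent, as \<open>A\<^sup>m\<^sup>+\<^sup>1 D = A\<^sup>m\<close>. This gives
  \<open>D1 A\<^sup>m = - D B D A\<^sup>m + (I - A D) S D\<close>, where \<open>S\<close> is the infinitesimal part of the
  \<open>m\<close>-th power. The sum in the conclusion is \<open>(I - A D) S D\<close>: each \<open>A\<^sup>i D\<close> that appears to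
  the right of \<open>B\<close> with \<open>i < m\<close> is rewritten as \<open>D\<^sup>m\<^sup>-\<^sup>i\<^sup>+\<^sup>1 A\<^sup>m\<close>.\<close>

lemma dual_drazin_inf_part_times_power:
  fixes A B D D1 :: "real^'n^'n"
  assumes "is_drazin m (dual_mat A B) (dual_mat D D1)"
  shows "D1 ** matpow A m = - (D ** B ** D ** matpow A m)
    + (\<Sum>i=0..<m. (mat 1 - A ** D) ** matpow A i ** B ** matpow D (i + 2) ** matpow A m)"
proof -
  define C where "C = matpow A m"
  define S where "S = (\<Sum>i=1..m. matpow A (m - i) ** B ** matpow A (i - 1))"
  define Q where "Q = mat 1 - A ** D"
  have drazin: "is_drazin m A D"
    using assms by (rule is_drazin_std_part)
  then have D: "D ** (A ** C) = C" "D ** A ** D = D" "A ** D = D ** A"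
    by (auto simp: is_drazin_def C_def)
  have CA: "A ** C = C ** A" and CD: "D ** C = C ** D"
    unfolding C_def using D(3) matpow_commute by metis+
  have pow: "matpow (dual_mat A B) m = dual_mat C S"
    by (simp add: matpow_dual_mat C_def S_def)
  then have "matpow (dual_mat A B) (m + 1) = dual_mat (A ** C) (A ** S + B ** C)"
    by (simp add: dual_mat_mult)
  with pow have "D ** (A ** S + B ** C) + D1 ** (A ** C) = S"
    using assms
    by (simp add: is_drazin_def dual_mat_mult dual_mat_eq_iff del: matpow.simps)
  then have "D1 ** (A ** C) = S - D ** (A ** S + B ** C)"
    by (simp add: algebra_simps)
  also have "\<dots> = Q ** S - D ** B ** C"
    using D(3) by (simp add: Q_def matrix_ring_simps)
  finally have "D1 ** (A ** C) ** D = Q ** S ** D - D ** B ** (C ** D)"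
    by (simp add: matrix_diff_rdist matrix_mul_assoc)
  moreover have "A ** C ** D = C"
    using D CA CD by (metis matrix_mul_assoc)
  ultimately have D1C: "D1 ** C = - (D ** B ** D ** C) + Q ** S ** D"
    using CD by (simp add: matrix_mul_assoc[symmetric])
  have shift: "matpow A i ** D = matpow D (m - Suc i + 2) ** C" if "i < m" for i
  proof -
    define j where "j = m - Suc i"
    have "C = matpow A j ** A ** matpow A i"
      using that matpow_add[of A "Suc j" i] matpow_Suc2[of A j] by (simp add: C_def j_def)
    then have "matpow D (j + 2) ** C
        = D ** (D ** matpow D j ** matpow A j) ** (A ** matpow A i)"
      by (simp add: matrix_mul_assoc)
    also have "D ** matpow D j ** matpow A j = matpow D j ** matpow A j ** D"
      using matpow_commute[of D D j] matpow_commute[of D A j] D(3) by (metis matrix_mul_assoc)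
    also have "\<dots> = D"
      using drazin by (rule drazin_power_cancel)
    also have "D ** D ** (A ** matpow A i) = D ** A ** D ** matpow A i"
      using D(3) by (metis matrix_mul_assoc)
    also have "\<dots> = matpow A i ** D"
      using D(2,3) matpow_commute[of D A i] by simp
    finally show ?thesis
      by (simp add: j_def)
  qed
  \<comment> \<open>The two sums run in opposite directions.\<close>
  have "Q ** S ** D = (\<Sum>i=1..m. Q ** matpow A (m - i) ** B ** (matpow A (i - 1) ** D))"
    by (simp add: S_def matrix_sum_ldist matrix_sum_rdist matrix_mul_assoc)
  also have "\<dots> = (\<Sum>i=0..<m. Q ** matpow A i ** B ** (matpow D (i + 2) ** C))"
  proof (rule sum.reindex_bij_witness[of _ "\<lambda>i. m - i" "\<lambda>i. m - i"])
    fix i assume "i \<in> {1..m}"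
    then have "i - 1 < m" "m - Suc (i - 1) = m - i"
      by auto
    with shift[of "i - 1"] show "Q ** matpow A (m - i) ** B ** (matpow D (m - i + 2) ** C)
        = Q ** matpow A (m - i) ** B ** (matpow A (i - 1) ** D)"
      by (simp del: matpow.simps)
  qed auto
  finally show ?thesis
    using D1C by (simp add: C_def Q_def matrix_mul_assoc)
qed


section \<open>The dual core-EP inverse\<close>

theorem theorem4p6:
  fixes A B S :: "real^'n^'n" and m :: nat
  assumes "mat_index A = m"
    and "S = (\<Sum>i=1..m. matpow A (m - i) ** B ** matpow A (i - 1))"
    and "has_dual_core_ep (dual_mat A B)"
    and "has_dual_drazin (dual_mat A B)"
  shows "(dual_core_ep (dual_mat A B) =
           dual_drazin (dual_mat A B) ** matpow (dual_mat A B) m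
             ** moore_penrose (matpow (dual_mat A B) m)) \<and>
         (dual_core_ep (dual_mat A B) =
           dual_mat (core_ep A)
             (- (core_ep A ** S ** moore_penrose (matpow A m))
              + drazin A ** matpow A m
                  ** moore_penrose (transpose (matpow A m) ** matpow A m)
                  ** transpose S
                  ** (mat 1 - matpow A m ** moore_penrose (matpow A m))
              + drazin A ** S ** moore_penrose (matpow A m)
              - drazin A ** B ** drazin A ** matpow A m ** moore_penrose (matpow A m)
              + (\<Sum>i=0..<m. spectral_proj A ** matpow A i ** B ** matpow (drazin A) (i + 2)
                   ** matpow A m ** moore_penrose (matpow A m))))"
proof -
  define C P where "C = matpow A m" and "P = moore_penrose C"
  obtain X where X: "is_drazin m (dual_mat A B) X"
    using assms(1,4) by (auto simp: has_dual_drazin_def)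
  define D D1 where "D = std_mat X" and "D1 = inf_mat X"
  have XD: "X = dual_mat D D1"
    by (simp add: D_def D1_def)
  have drazin: "is_drazin m A D"
    using X is_drazin_std_part unfolding XD by blast
  have pow: "matpow (dual_mat A B) m = dual_mat C S"
    by (simp add: matpow_dual_mat C_def assms(2))
  have P: "is_moore_penrose C P"
    unfolding P_def by (rule is_moore_penrose_moore_penrose)
  have gram: "moore_penrose (transpose C ** C) = P ** transpose P"
    using P by (intro moore_penrose_eqI moore_penrose_gram)

  have "(mat 1 - C ** P) ** S ** (mat 1 - P ** C) = 0"
    using P drazin_power_inner_inverse[OF X, of m] unfolding pow
    by (rule dual_inner_inverse_obstruction)
  then have dual_P: "is_moore_penrose (dual_mat C S)
    (dual_mat P (- (P ** S ** P) + P ** transpose P ** transpose S ** (mat 1 - C ** P)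
      + (mat 1 - P ** C) ** transpose S ** transpose P ** P))"
    (is "is_moore_penrose _ (dual_mat P ?P1)")
    using P by (intro dual_moore_penrose_formula)

  have core: "core_ep A = D ** C ** P"
    using is_core_ep_drazin_moore_penrose[OF drazin] P assms(1)
    by (intro core_ep_eqI) (simp add: C_def)
  have dual_core: "dual_core_ep (dual_mat A B) = X ** dual_mat C S ** dual_mat P ?P1"
    using is_core_ep_drazin_moore_penrose[OF X] dual_P assms(1)
    by (intro dual_core_ep_eqI) (simp add: pow)
  have dual_D: "dual_drazin (dual_mat A B) = X"
    using X assms(1) by (intro dual_drazin_eqI) simp
  have D: "drazin A = D"
    using drazin assms(1) by (intro drazin_eqI) simp
  have proj: "spectral_proj A = mat 1 - A ** D"
    by (simp add: spectral_proj_def D)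

  have "D ** C ** ?P1 = - (D ** C ** P ** S ** P)
      + D ** C ** (P ** transpose P) ** transpose S ** (mat 1 - C ** P)"
    by (simp add: matrix_ring_simps is_moore_penrose_simps[OF P])
  moreover have "D1 ** C ** P = - (D ** B ** D ** C ** P)
      + (\<Sum>i=0..<m. (mat 1 - A ** D) ** matpow A i ** B ** matpow D (i + 2) ** C ** P)"
    unfolding C_def dual_drazin_inf_part_times_power[OF X[unfolded XD]]
    by (simp only: matrix_add_rdist matrix_minus_left matrix_sum_rdist)
  ultimately have "X ** dual_mat C S ** dual_mat P ?P1 = dual_mat (D ** C ** P)
     (- (D ** C ** P ** S ** P)
      + D ** C ** (P ** transpose P) ** transpose S ** (mat 1 - C ** P)
      + D ** S ** P - D ** B ** D ** C ** P
      + (\<Sum>i=0..<m. (mat 1 - A ** D) ** matpow A i ** B ** matpow D (i + 2) ** C ** P))"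
    by (simp add: XD dual_mat_mult dual_mat_eq_iff matrix_add_rdist)
  then show ?thesis
    unfolding dual_core dual_D pow moore_penrose_eqI[OF dual_P]
    unfolding C_def[symmetric] P_def[symmetric] gram core D proj
    by simp
qed

end
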